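(* Let $n\ge 3$ and let $\Pi'_n=a_1a_2\cdots a_{n!+n-1}$ be the output of the greedy algorithm described in the context, and for $1\le k\le n!$ let $\sigma_k=\mathrm{red}(a_k a_{k+1}\cdots a_{k+n-1})$. Then $a_{\frac{n!}{2}+1}=1$, $$\sigma_{\frac{n!}{2}}=n12\cdots(n-1),\qquad \sigma_{\frac{n!}{2}+1}=134\cdots n2,\qquad \sigma_{\frac{n!}{2}+2}=23\cdots(n-1)1n,$$ and $$\{\sigma_k:\ 1\le k\le n!/2\}=S_{n,1},\qquad \{\sigma_k:\ n!/2<k\le n!\}=S_{1,n},$$ where $S_{1,n}$ (resp. $S_{n,1}$) is the set of permutations of $\{1,\dots,n\}$ in which the entry $1$ appears before (resp. after) the entry $n$.
   Context: For a word $w$ of distinct integers, $\mathrm{red}(w)$ denotes the word obtained by replacing the $i$-th smallest entry of $w$ by $i$. A factor of a word is a block of consecutive letters. Extensions: for a word $\pi=\pi_1\cdots\pi_m$ of distinct integers and $1\le i\le m$, the $i$-th extension of $\pi$ is $c_b(\pi_1)\cdots c_b(\pi_m)\,b$, where $b$ is the $i$-th smallest element of $\{\pi_1,\dots,\pi_m\}$ and $c_b(x)=x$ if $x<b$, $c_b(x)=x+1$ if $x\ge b$. The $(m+1)$-st extension of $\pi$ is $\pi b$ with $b=\max_j\pi_j+1$. Greedy algorithm: start with $\Pi'_{n,0}=12\cdots(n-1)$. Given $\Pi'_{n,k}=a_1a_2\cdots a_{k+n-1}$ (a permutation of $\{1,\dots,k+n-1\}$ in which no two factors of length $n$ have the same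 reduced form), let $i\in\{1,\dots,n\}$ be minimal such that the $i$-th extension of $a_{k+1}\cdots a_{k+n-1}$ has reduced form different from the reduced form of every length-$n$ factor of $\Pi'_{n,k}$, let $b$ be the last element of this extension, and set $\Pi'_{n,k+1}=c_b(a_1)\cdots c_b(a_{k+n-1})\,b$. If no such $i$ exists, the algorithm terminates and outputs $\Pi'_n:=\Pi'_{n,k}$. The output $\Pi'_n$ is a permutation of $\{1,\dots,n!+n-1\}$ whose $n!$ length-$n$ factors have pairwise distinct reduced forms covering all permutations of $\{1,\dots,n\}$. *)

theory Defs
  imports
    "HOL-Library.Sublist"
    "HOL-Library.While_Combinator"
    "HOL-Combinatorics.Multiset_Permutations"
begin

definition red :: "nat list \<Rightarrow> nat list" where
  "red w = map (\<lambda>x. card {y \<in> set w. y \<le> x}) w"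

definition shift :: "nat \<Rightarrow> nat \<Rightarrow> nat" where
  "shift b x = (if x < b then x else x + 1)"

text \<open>Meaningful for \<open>1 \<le> i \<le> length w + 1\<close> and \<open>w\<close> nonempty with distinct letters.\<close>

definition extension :: "nat \<Rightarrow> nat list \<Rightarrow> nat list" where
  "extension i w =
    (if i \<le> length w
     then (let b = sort w ! (i - 1) in map (shift b) w @ [b])
     else w @ [Max (set w) + 1])"

definition admissible :: "nat \<Rightarrow> nat list \<Rightarrow> nat \<Rightarrow> bool" where
  "admissible n w i \<longleftrightarrow>
    i \<in> {1..n} \<and>
    (\<forall>u. sublist u w \<and> length u = n \<longrightarrow>
      red (extension i (drop (length w - (n - 1)) w)) \<noteq> red u)"

definition greedy_step :: "nat \<Rightarrow> nat list \<Rightarrow> nat list" where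
  "greedy_step n w =
    (let i = (LEAST i. admissible n w i);
         b = last (extension i (drop (length w - (n - 1)) w))
     in map (shift b) w @ [b])"

text \<open>The constant \<open>while\<close> returns an unspecified word if the loop diverges, so no property of
  the output comes for free without termination.\<close>

definition greedy_output :: "nat \<Rightarrow> nat list" where
  "greedy_output n = while (\<lambda>w. \<exists>i. admissible n w i) (greedy_step n) [1..<n]"

text \<open>Letters and factors are numbered from 1 in the mathematics, list positions from 0;
  hence \<open>k - 1\<close> below, and the \<open>k\<close>-th letter of \<open>w\<close> is \<open>w ! (k - 1)\<close>.\<close>

definition sigma :: "nat \<Rightarrow> nat \<Rightarrow> nat list" where
  "sigma n k = red (take n (drop (k - 1) (greedy_output n)))"

definition perms_before :: "nat \<Rightarrow> nat \<Rightarrow> nat \<Rightarrow> nat list set" where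
  "perms_before n x y =
    {p \<in> permutations_of_set {1..n}. \<exists>i j. i < j \<and> j < length p \<and> p ! i = x \<and> p ! j = y}"

end

theory Submission
  imports Defs
begin

text \<open>
  The patterns of length \<open>n\<close> are the edges of a graph on the permutations of \<open>{1..n-1}\<close>, an edge \<open>e\<close>
  going from \<open>red (butlast e)\<close> to \<open>red (tl e)\<close>; the algorithm walks through this graph, leaving a
  vertex along the unused edge of smallest final entry. Both the set of all edges and the set
  \<open>F\<close> of edges with \<open>n\<close> before \<open>1\<close> are balanced, and at every vertex \<open>F\<close> consists of the edges
  that the algorithm prefers. Hence the walk stays in \<open>F\<close> until it is stuck there, which by balance
  happens at the starting vertex \<open>12\<dots>(n-1)\<close>, with all \<open>F\<close>-edges at that vertex used. If all
  \<open>F\<close>-edges entering a vertex \<open>v\<close> are used and the least preferred \<open>F\<close>-edge of \<open>u\<close> leads to \<open>v\<close>,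
  then all \<open>F\<close>-edges leaving \<open>u\<close> are used and, by balance, those entering \<open>u\<close> as well. Since the least
  preferred \<open>F\<close>-edges lead from every vertex to the starting vertex, the walk has exhausted \<open>F\<close>.
  The same argument for the set of all edges shows that the output contains every pattern.
\<close>

section \<open>Reduced words\<close>

text \<open>Ranks depend only on the relative order of the letters. This makes reduced forms
  insensitive to the renumbering by \<open>shift\<close>.\<close>

lemma red_map_strict_mono:
  assumes "strict_mono_on (set w) f"
  shows "red (map f w) = red w"
proof -
  have "card {y \<in> f ` set w. y \<le> f x} = card {y \<in> set w. y \<le> x}" if x: "x \<in> set w" for x
  proof -
    have "{y \<in> f ` set w. y \<le> f x} = f ` {y \<in> set w. y \<le> x}"
      using strict_mono_on_less_eq[OF assms _ x] by auto
    moreover have "inj_on f {y \<in> set w. y \<le> x}"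
      using strict_mono_on_imp_inj_on[OF assms] by (rule inj_on_subset) auto
    ultimately show ?thesis by (simp add: card_image)
  qed
  then show ?thesis by (simp add: red_def)
qed

lemma strict_mono_on_rank:
  "strict_mono_on (set w) (\<lambda>x::nat. card {y \<in> set w. y \<le> x})"
proof (rule strict_mono_onI)
  fix r s assume "r \<in> set w" "s \<in> set w" "r < s"
  then show "card {y \<in> set w. y \<le> r} < card {y \<in> set w. y \<le> s}"
    by (intro psubset_card_mono) (simp_all add: psubset_eq set_eq_iff, force)
qed

lemma strict_mono_on_shift: "strict_mono_on A (shift b)"
  by (auto simp: strict_mono_on_def shift_def)

lemma inj_shift: "inj (shift b)"
  by (auto simp: inj_def shift_def split: if_splits)

lemma shift_neq [simp]: "shift b x \<noteq> b"
  by (auto simp: shift_def)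

lemma length_red [simp]: "length (red w) = length w"
  by (simp add: red_def)

lemma red_in_permutations:
  assumes "distinct w"
  shows "red w \<in> permutations_of_set {1..length w}"
proof -
  have d: "distinct (red w)"
    using assms strict_mono_on_imp_inj_on[OF strict_mono_on_rank]
    by (simp add: red_def distinct_map)
  have "set (red w) \<subseteq> {1..length w}"
  proof
    fix r assume "r \<in> set (red w)"
    then obtain x where x: "x \<in> set w" "r = card {y \<in> set w. y \<le> x}" by (auto simp: red_def)
    have "0 < r" using x by (auto simp: card_gt_0_iff)
    moreover have "r \<le> card (set w)" unfolding x by (intro card_mono) auto
    ultimately show "r \<in> {1..length w}" using card_length[of w] by simp
  qed
  moreover have "card (set (red w)) = card {1..length w}"
    using distinct_card[OF d] by simp
  ultimately have "set (red w) = {1..length w}" by (intro card_subset_eq) auto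
  then show ?thesis using d by (simp add: permutations_of_set_def)
qed

lemma red_permutation:
  assumes "p \<in> permutations_of_set {1..m}"
  shows "red p = p"
proof -
  have p: "set p = {1..m}" using assms by (rule permutations_of_setD)
  have "card {y \<in> set p. y \<le> x} = x" if "x \<in> set p" for x
  proof -
    have "{y \<in> set p. y \<le> x} = {1..x}" using that p by auto
    then show ?thesis by simp
  qed
  then show ?thesis unfolding red_def by (rule map_idI)
qed

text \<open>Taking ranks is itself a strictly increasing relabelling, so it may be applied before
  the first letter is deleted.\<close>

lemma red_tl_red: "red (tl (red w)) = red (tl w)"
proof -
  have "strict_mono_on (set (tl w)) (\<lambda>x. card {y \<in> set w. y \<le> x})"
    by (rule monotone_on_subset[OF strict_mono_on_rank]) (cases w; auto)
  then show ?thesis by (simp add: red_def[of w] map_tl[symmetric] red_map_strict_mono)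
qed

section \<open>Adding a letter of prescribed rank at either end\<close>

text \<open>For a permutation \<open>p\<close>, this is the edge that leaves the vertex
  \<open>p\<close> and has last entry \<open>i\<close>; \<open>cons_rank i p\<close> is the edge
  that enters \<open>p\<close> and has first entry \<open>i\<close>.\<close>

definition snoc_rank :: "nat \<Rightarrow> nat list \<Rightarrow> nat list" where
  "snoc_rank i p = map (shift i) p @ [i]"

definition cons_rank :: "nat \<Rightarrow> nat list \<Rightarrow> nat list" where
  "cons_rank i p = i # map (shift i) p"

text \<open>The new letter raises the ranks of the larger letters by one and keeps those of the
  smaller ones, which is the effect of \<open>shift\<close> at its own rank.\<close>

lemma red_snoc:
  assumes "b \<notin> set u"
  shows "red (u @ [b]) = snoc_rank (Suc (card {x \<in> set u. x < b})) (red u)"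
proof -
  let ?i = "Suc (card {x \<in> set u. x < b})"
  have "{y \<in> set (u @ [b]). y \<le> b} = insert b {x \<in> set u. x < b}"
    using assms by (auto simp: le_less)
  then have b: "card {y \<in> set (u @ [b]). y \<le> b} = ?i" by simp
  have "card {y \<in> set (u @ [b]). y \<le> x} = shift ?i (card {y \<in> set u. y \<le> x})"
    if x: "x \<in> set u" for x
  proof (cases "x < b")
    case True
    then have "{y \<in> set (u @ [b]). y \<le> x} = {y \<in> set u. y \<le> x}" by auto
    moreover have "card {y \<in> set u. y \<le> x} \<le> card {x \<in> set u. x < b}"
      using True by (intro card_mono) auto
    ultimately show ?thesis by (simp add: shift_def)
  next
    case False
    with x assms have "b < x" by (metis linorder_neqE_nat)
    then have "{y \<in> set (u @ [b]). y \<le> x} = insert b {y \<in> set u. y \<le> x}" by auto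
    moreover have "card {x \<in> set u. x < b} < card {y \<in> set u. y \<le> x}"
    proof (rule psubset_card_mono)
      have "x \<in> {y \<in> set u. y \<le> x}" "x \<notin> {x \<in> set u. x < b}" using \<open>b < x\<close> x by simp_all
      moreover have "{x \<in> set u. x < b} \<subseteq> {y \<in> set u. y \<le> x}" using \<open>b < x\<close> by fastforce
      ultimately show "{x \<in> set u. x < b} \<subset> {y \<in> set u. y \<le> x}" by blast
    qed simp
    ultimately show ?thesis using assms by (simp add: shift_def)
  qed
  then show ?thesis using b by (simp add: red_def snoc_rank_def)
qed

text \<open>Lets a step of the walk be computed on any word \<open>u\<close> that represents the
  vertex: append a letter of the right rank, drop the first letter, and never renumber.\<close>

lemma red_tl_snoc_rank:
  assumes "b \<notin> set u" "u \<noteq> []" "i = Suc (card {x \<in> set u. x < b})"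
  shows "red (tl (snoc_rank i (red u))) = red (tl u @ [b])"
  using red_snoc[OF assms(1)] red_tl_red[of "u @ [b]"] assms(2,3) by simp

section \<open>Extensions expressed by ranks\<close>

lemma card_less_sort_nth:
  fixes v :: "nat list"
  assumes "distinct v" "k < length v"
  shows "card {x \<in> set v. x < sort v ! k} = k"
proof -
  have s: "sort v ! i < sort v ! j \<longleftrightarrow> i < j" if "i < length v" "j < length v" for i j
    using that assms(1) sorted_wrt_nth_less[of "(<)" "sort v"]
    by (metis distinct_sort length_sort linorder_neqE_nat order_less_asym strict_sorted_iff sorted_sort)
  have "{x \<in> set v. x < sort v ! k} = (!) (sort v) ` {..<k}"
  proof (intro set_eqI iffI)
    fix x assume "x \<in> {x \<in> set v. x < sort v ! k}"
    then have "x \<in> set (sort v)" "x < sort v ! k" by auto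
    then obtain i where "i < length v" "x = sort v ! i" by (metis in_set_conv_nth length_sort)
    then show "x \<in> (!) (sort v) ` {..<k}" using s[of i k] \<open>x < _\<close> assms(2) by auto
  next
    fix x assume "x \<in> (!) (sort v) ` {..<k}"
    then obtain i where "i < k" "x = sort v ! i" by auto
    moreover from this have "x \<in> set (sort v)" using assms(2) by (simp del: set_sort)
    ultimately show "x \<in> {x \<in> set v. x < sort v ! k}" using s[of i k] assms(2) by auto
  qed
  moreover have "inj_on ((!) (sort v)) {..<k}"
    using assms by (intro inj_on_nth) auto
  ultimately show ?thesis by (simp add: card_image)
qed

text \<open>The last extension also has the general form, because shifting at a value above all
  letters changes nothing. In both cases \<open>i\<close> is the rank of the new letter
  \<open>b\<close>.\<close>

lemma extension_eq_shift:
  assumes "distinct v" "v \<noteq> []" "i \<in> {1..Suc (length v)}" "\<forall>x\<in>set v. 1 \<le> x"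
  obtains b where "extension i v = map (shift b) v @ [b]" "1 \<le> b"
    "i = Suc (card {x \<in> set v. x < b})"
proof (cases "i \<le> length v")
  case True
  let ?b = "sort v ! (i - 1)"
  have "?b \<in> set (sort v)" using True assms(3) by (intro nth_mem) auto
  then have "1 \<le> ?b" using assms(4) by auto
  moreover have "i = Suc (card {x \<in> set v. x < ?b})"
    using card_less_sort_nth[OF assms(1), of "i - 1"] True assms(3) by simp
  moreover have "extension i v = map (shift ?b) v @ [?b]"
    using True by (simp add: extension_def Let_def)
  ultimately show ?thesis using that by blast
next
  case False
  let ?b = "Max (set v) + 1"
  have lt: "\<forall>x\<in>set v. x < ?b" by (simp add: less_Suc_eq_le)
  then have "{x \<in> set v. x < ?b} = set v" by auto
  then have "i = Suc (card {x \<in> set v. x < ?b})"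
    using False assms(1,3) by (simp add: distinct_card)
  moreover have "extension i v = map (shift ?b) v @ [?b]"
    using False lt by (simp add: extension_def shift_def map_idI)
  ultimately show ?thesis using that[of ?b] by simp
qed

text \<open>Shifting frees the value \<open>b\<close> and fixes the letters below it, so the rank of
  \<open>b\<close> can be counted in \<open>v\<close> itself.\<close>

lemma red_map_shift_snoc:
  assumes "i = Suc (card {x \<in> set v. x < b})"
  shows "red (map (shift b) v @ [b]) = snoc_rank i (red v)"
proof -
  have "{x \<in> set (map (shift b) v). x < b} = {x \<in> set v. x < b}"
    by (auto simp: shift_def image_iff)
  moreover have "b \<notin> set (map (shift b) v)"
    by (metis imageE image_set shift_neq)
  ultimately show ?thesis
    using red_snoc[of b "map (shift b) v"] red_map_strict_mono[OF strict_mono_on_shift] assms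
    by metis
qed

lemma red_extension:
  assumes "distinct v" "v \<noteq> []" "i \<in> {1..Suc (length v)}" "\<forall>x\<in>set v. 1 \<le> x"
  shows "red (extension i v) = snoc_rank i (red v)"
  using extension_eq_shift[OF assms] red_map_shift_snoc by metis

section \<open>The graph of overlapping permutations\<close>

lemma shift_image: "i \<in> {1..Suc m} \<Longrightarrow> shift i ` {1..m} = {1..Suc m} - {i}"
proof (intro set_eqI iffI)
  fix x assume i: "i \<in> {1..Suc m}" and x: "x \<in> {1..Suc m} - {i}"
  show "x \<in> shift i ` {1..m}"
  proof (cases "x < i")
    case True then show ?thesis using i x by (intro image_eqI[of _ _ x]) (auto simp: shift_def)
  next
    case False then show ?thesis using i x by (intro image_eqI[of _ _ "x - 1"]) (auto simp: shift_def)
  qed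
qed (auto simp: shift_def)

lemma snoc_rank_in_permutations:
  assumes "p \<in> permutations_of_set {1..m}" "i \<in> {1..Suc m}"
  shows "snoc_rank i p \<in> permutations_of_set {1..Suc m}"
  using assms shift_image[OF assms(2)] inj_on_subset[OF inj_shift]
  by (auto simp: snoc_rank_def permutations_of_set_def distinct_map)

lemma cons_rank_in_permutations:
  assumes "p \<in> permutations_of_set {1..m}" "i \<in> {1..Suc m}"
  shows "cons_rank i p \<in> permutations_of_set {1..Suc m}"
  using assms shift_image[OF assms(2)] inj_on_subset[OF inj_shift]
  by (auto simp: cons_rank_def permutations_of_set_def distinct_map)

lemma red_butlast_snoc_rank:
  "p \<in> permutations_of_set {1..m} \<Longrightarrow> red (butlast (snoc_rank i p)) = p"
  by (simp add: snoc_rank_def red_map_strict_mono strict_mono_on_shift red_permutation)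

lemma red_tl_cons_rank:
  "p \<in> permutations_of_set {1..m} \<Longrightarrow> red (tl (cons_rank i p)) = p"
  by (simp add: cons_rank_def red_map_strict_mono strict_mono_on_shift red_permutation)

lemma snoc_rank_inject:
  assumes "p \<in> permutations_of_set {1..m}" "q \<in> permutations_of_set {1..m}"
    and "snoc_rank i p = snoc_rank j q"
  shows "i = j" "p = q"
proof -
  show "i = j" using assms(3) by (simp add: snoc_rank_def)
  show "p = q" using assms red_butlast_snoc_rank by metis
qed

lemma red_tl_in_permutations:
  assumes "e \<in> permutations_of_set {1..Suc m}"
  shows "red (tl e) \<in> permutations_of_set {1..m}"
  using red_in_permutations[of "tl e"] assms length_finite_permutations_of_set[OF assms]
  by (simp add: distinct_tl permutations_of_setD)

lemma permutation_eq_snoc_rank: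
  assumes "e \<in> permutations_of_set {1..Suc m}"
  obtains i where "i \<in> {1..Suc m}" "red (butlast e) \<in> permutations_of_set {1..m}"
    "e = snoc_rank i (red (butlast e))"
proof -
  have len: "length e = Suc m" using length_finite_permutations_of_set[OF assms] by simp
  then obtain u b where e: "e = u @ [b]" by (metis length_Suc_conv_rev)
  have d: "distinct (u @ [b])" "set (u @ [b]) = {1..Suc m}"
    using assms e by (auto simp: permutations_of_set_def)
  let ?i = "Suc (card {x \<in> set u. x < b})"
  have "red e = snoc_rank ?i (red (butlast e))"
    using red_snoc[of b u] d(1) by (simp add: e)
  then have "e = snoc_rank ?i (red (butlast e))"
    using red_permutation[OF assms] by simp
  moreover have "card {x \<in> set u. x < b} \<le> card (set u)" by (intro card_mono) auto
  then have "?i \<in> {1..Suc m}" using card_length[of u] len e by simp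
  moreover have "red (butlast e) \<in> permutations_of_set {1..m}"
    using red_in_permutations[of u] d len e by simp
  ultimately show ?thesis using that by blast
qed

text \<open>The letters after the first are all values except \<open>hd e\<close>: those below it
  equal their rank and those above exceed it by one, so \<open>shift (hd e)\<close> recovers
  them.\<close>

lemma permutation_eq_cons_rank:
  assumes "e \<in> permutations_of_set {1..Suc m}"
  shows "hd e \<in> {1..Suc m}" "e = cons_rank (hd e) (red (tl e))"
proof -
  have len: "length e = Suc m" using length_finite_permutations_of_set[OF assms] by simp
  then obtain a u where e: "e = a # u" by (metis length_Suc_conv)
  have d: "distinct (a # u)" "set (a # u) = {1..Suc m}"
    using assms e by (auto simp: permutations_of_set_def)
  then show "hd e \<in> {1..Suc m}" using e by auto
  have mem: "y \<in> set u \<longleftrightarrow> 1 \<le> y \<and> y \<le> Suc m \<and> y \<noteq> a" for y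
    using d by (metis atLeastAtMost_iff distinct.simps(2) insert_iff list.simps(15))
  have a: "1 \<le> a" using \<open>hd e \<in> {1..Suc m}\<close> e by simp
  have "shift a (card {y \<in> set u. y \<le> x}) = x" if x: "x \<in> set u" for x
  proof (cases "x < a")
    case True
    have "{y \<in> set u. y \<le> x} = {1..x}" unfolding mem using True x mem[of x] by auto
    then show ?thesis using True by (simp add: shift_def)
  next
    case False
    have "{y \<in> set u. y \<le> x} = {1..x} - {a}" unfolding mem using x mem[of x] by auto
    moreover have "a < x" using False x mem[of x] by simp
    ultimately show ?thesis using a by (simp add: shift_def)
  qed
  then show "e = cons_rank (hd e) (red (tl e))"
    by (simp add: e cons_rank_def red_def map_idI)
qed

lemma edges_with_tail:
  assumes "p \<in> permutations_of_set {1..m}"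
  shows "{e \<in> permutations_of_set {1..Suc m}. red (butlast e) = p} =
    (\<lambda>i. snoc_rank i p) ` {1..Suc m}"
proof (intro set_eqI iffI)
  fix e assume "e \<in> {e \<in> permutations_of_set {1..Suc m}. red (butlast e) = p}"
  then show "e \<in> (\<lambda>i. snoc_rank i p) ` {1..Suc m}"
    using permutation_eq_snoc_rank[of e m] by blast
qed (use red_butlast_snoc_rank[OF assms] snoc_rank_in_permutations[OF assms] in auto)

lemma edges_with_head:
  assumes "p \<in> permutations_of_set {1..m}"
  shows "{e \<in> permutations_of_set {1..Suc m}. red (tl e) = p} =
    (\<lambda>i. cons_rank i p) ` {1..Suc m}"
proof (intro set_eqI iffI)
  fix e assume "e \<in> {e \<in> permutations_of_set {1..Suc m}. red (tl e) = p}"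
  then show "e \<in> (\<lambda>i. cons_rank i p) ` {1..Suc m}"
    using permutation_eq_cons_rank[of e m] by (intro image_eqI[of _ _ "hd e"]) auto
qed (use red_tl_cons_rank[OF assms] cons_rank_in_permutations[OF assms] in auto)

lemma inj_snoc_rank: "inj (\<lambda>i. snoc_rank i p)"
  by (auto simp: inj_def snoc_rank_def)

lemma inj_cons_rank: "inj (\<lambda>i. cons_rank i p)"
  by (auto simp: inj_def cons_rank_def)

section \<open>Permutations with the maximum before the minimum\<close>

text \<open>A recursive form of the condition on positions in \<open>perms_before\<close>, suited to
  induction over append, map and reversal.\<close>

fun occurs_before :: "'a list \<Rightarrow> 'a \<Rightarrow> 'a \<Rightarrow> bool" where
  "occurs_before [] x y = False"
| "occurs_before (a # xs) x y = (a = x \<and> y \<in> set xs \<or> occurs_before xs x y)"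

lemma occurs_before_iff_nth:
  "occurs_before xs x y \<longleftrightarrow> (\<exists>i j. i < j \<and> j < length xs \<and> xs ! i = x \<and> xs ! j = y)"
proof (induction xs)
  case (Cons a xs)
  have "(\<exists>i j. i < j \<and> j < length (a # xs) \<and> (a # xs) ! i = x \<and> (a # xs) ! j = y) \<longleftrightarrow>
    (\<exists>j < length xs. a = x \<and> xs ! j = y) \<or>
    (\<exists>i j. i < j \<and> j < length xs \<and> xs ! i = x \<and> xs ! j = y)" (is "?L \<longleftrightarrow> ?R")
  proof
    assume ?L
    then obtain i j where "i < j" "j < length (a # xs)" "(a # xs) ! i = x" "(a # xs) ! j = y"
      by blast
    then show ?R by (cases i; cases j) auto
  next
    assume ?R
    then show ?L
    proof (elim disjE exE conjE)
      fix j assume "j < length xs" "a = x" "xs ! j = y"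
      then show ?L by (intro exI[of _ 0] exI[of _ "Suc j"]) simp
    next
      fix i j assume "i < j" "j < length xs" "xs ! i = x" "xs ! j = y"
      then show ?L by (intro exI[of _ "Suc i"] exI[of _ "Suc j"]) simp
    qed
  qed
  then show ?case using Cons.IH by (auto simp: in_set_conv_nth)
qed simp

lemma perms_before_eq:
  "perms_before n x y = {p \<in> permutations_of_set {1..n}. occurs_before p x y}"
  by (simp add: perms_before_def occurs_before_iff_nth)

lemma occurs_before_append:
  "occurs_before (xs @ ys) x y \<longleftrightarrow>
    occurs_before xs x y \<or> occurs_before ys x y \<or> x \<in> set xs \<and> y \<in> set ys"
  by (induction xs) auto

lemma occurs_before_in_set: "occurs_before xs x y \<Longrightarrow> x \<in> set xs \<and> y \<in> set xs"
  by (induction xs) auto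

lemma occurs_before_map:
  assumes "inj f"
  shows "occurs_before (map f xs) (f x) (f y) \<longleftrightarrow> occurs_before xs x y"
  using assms by (induction xs) (auto simp: inj_eq image_iff)

lemma occurs_before_mapI: "occurs_before xs x y \<Longrightarrow> occurs_before (map f xs) (f x) (f y)"
  by (induction xs) auto

lemma occurs_before_rev: "occurs_before (rev xs) x y \<longleftrightarrow> occurs_before xs y x"
  by (induction xs) (auto simp: occurs_before_append)

lemma occurs_before_linear:
  assumes "distinct xs" "x \<in> set xs" "y \<in> set xs" "x \<noteq> y"
  shows "occurs_before xs x y \<longleftrightarrow> \<not> occurs_before xs y x"
  using assms by (induction xs) (auto dest: occurs_before_in_set)

text \<open>A last entry 1 comes after the maximum, and a last entry \<open>Suc m\<close> comes
  after 1. Any other last entry keeps the extreme letters of \<open>p\<close> extreme and in the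
  same order. The edges with maximum before minimum are thus an initial segment of the greedy
  choices at \<open>p\<close>.\<close>

lemma occurs_before_snoc_rank:
  assumes "p \<in> permutations_of_set {1..m}" "i \<in> {1..Suc m}" "1 \<le> m"
  shows "occurs_before (snoc_rank i p) (Suc m) 1 \<longleftrightarrow> i = 1 \<or> i \<le> m \<and> occurs_before p m 1"
proof -
  have p: "set p = {1..m}" using assms(1) by (rule permutations_of_setD)
  consider "i = 1" | "i = Suc m" "1 < i" | "1 < i" "i \<le> m" using assms(2) by fastforce
  then show ?thesis
  proof cases
    case 1
    have "Suc m = shift i m" using 1 assms(3) by (simp add: shift_def)
    then have "Suc m \<in> shift i ` set p" using p assms(3) by auto
    then show ?thesis using 1 by (simp add: snoc_rank_def occurs_before_append)
  next
    case 2
    have "map (shift i) p = p" by (rule map_idI) (use 2 p in \<open>auto simp: shift_def\<close>)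
    moreover have "\<not> occurs_before p (Suc m) 1" using p by (auto dest: occurs_before_in_set)
    ultimately show ?thesis using 2 by (simp add: snoc_rank_def occurs_before_append)
  next
    case 3
    have "shift i m = Suc m" "shift i 1 = 1" using 3 by (simp_all add: shift_def)
    then have "occurs_before (map (shift i) p) (Suc m) 1 \<longleftrightarrow> occurs_before p m 1"
      using occurs_before_map[OF inj_shift, of i p m 1] by simp
    then show ?thesis using 3 by (simp add: snoc_rank_def occurs_before_append)
  qed
qed

text \<open>The mirror image of the previous lemma; it supplies the in-degrees.\<close>

lemma occurs_before_cons_rank:
  assumes "p \<in> permutations_of_set {1..m}" "i \<in> {1..Suc m}" "1 \<le> m"
  shows "occurs_before (cons_rank i p) (Suc m) 1 \<longleftrightarrow> i = Suc m \<or> 2 \<le> i \<and> occurs_before p m 1"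
proof -
  have p: "set p = {1..m}" using assms(1) by (rule permutations_of_setD)
  consider "i = 1" | "i = Suc m" "1 < i" | "1 < i" "i \<le> m" using assms(2) by fastforce
  then show ?thesis
  proof cases
    case 1
    have "1 \<notin> set (map (shift i) p)" by (metis 1 imageE image_set shift_neq)
    then have "\<not> occurs_before (map (shift i) p) (Suc m) 1" by (meson occurs_before_in_set)
    then show ?thesis using 1 assms(3) by (simp add: cons_rank_def)
  next
    case 2
    have "1 = shift i 1" using 2 by (simp add: shift_def)
    then have "1 \<in> shift i ` set p" using p assms(3) by auto
    then show ?thesis using 2 by (simp add: cons_rank_def)
  next
    case 3
    have "shift i m = Suc m" "shift i 1 = 1" using 3 by (simp_all add: shift_def)
    then have "occurs_before (map (shift i) p) (Suc m) 1 \<longleftrightarrow> occurs_before p m 1"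
      using occurs_before_map[OF inj_shift, of i p m 1] by simp
    then show ?thesis using 3 by (simp add: cons_rank_def)
  qed
qed

lemma perms_before_complement:
  assumes "2 \<le> n"
  shows "perms_before n 1 n = permutations_of_set {1..n} - perms_before n n 1"
proof -
  have "occurs_before p 1 n \<longleftrightarrow> \<not> occurs_before p n 1" if "p \<in> permutations_of_set {1..n}" for p
    using permutations_of_setD[OF that] assms by (intro occurs_before_linear) auto
  then show ?thesis by (auto simp: perms_before_eq)
qed

text \<open>Reversal is a bijection onto the complementary set.\<close>

lemma card_perms_before:
  assumes "2 \<le> n"
  shows "card (perms_before n n 1) = fact n div 2"
proof -
  let ?A = "perms_before n n 1" and ?P = "permutations_of_set {1..n}"
  have rev: "rev p \<in> perms_before n x y \<longleftrightarrow> p \<in> perms_before n y x" for p x y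
    by (simp add: perms_before_eq occurs_before_rev permutations_of_set_def)
  have "rev ` ?A = perms_before n 1 n"
  proof (intro set_eqI iffI)
    fix p assume "p \<in> perms_before n 1 n"
    then have "rev p \<in> ?A" by (simp only: rev)
    then show "p \<in> rev ` ?A" by (rule rev_image_eqI) simp
  next
    fix p assume "p \<in> rev ` ?A"
    then show "p \<in> perms_before n 1 n" using rev by blast
  qed
  then have "card ?A = card (perms_before n 1 n)" using card_image[OF inj_on_rev, of ?A] by simp
  also have "\<dots> = card ?P - card ?A"
    unfolding perms_before_complement[OF assms]
    by (rule card_Diff_subset) (auto simp: perms_before_eq)
  finally have "card ?A = fact n - card ?A" by simp
  moreover have "card ?A \<le> card ?P" by (intro card_mono) (auto simp: perms_before_eq)
  ultimately show ?thesis by simp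
qed

section \<open>Greedy walks\<close>

text \<open>\<open>es\<close> lists the patterns used so far and \<open>p\<close> is the current
  vertex, the reduced form of the last \<open>m\<close> letters. The condition on \<open>j\<close>
  is the minimality of the greedy choice.\<close>

inductive greedy_walk :: "nat \<Rightarrow> nat list list \<Rightarrow> nat list \<Rightarrow> bool" for m where
  start: "greedy_walk m [] [1..<Suc m]"
| step: "\<lbrakk>greedy_walk m es p; i \<in> {1..Suc m}; snoc_rank i p \<notin> set es;
    \<forall>j\<in>{1..<i}. snoc_rank j p \<in> set es\<rbrakk>
    \<Longrightarrow> greedy_walk m (es @ [snoc_rank i p]) (red (tl (snoc_rank i p)))"

lemma upt_in_permutations: "[1..<Suc m] \<in> permutations_of_set {1..m}"
  by (auto simp: permutations_of_set_def)

lemma greedy_walk_wf: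
  assumes "greedy_walk m es p"
  shows "p \<in> permutations_of_set {1..m}" "set es \<subseteq> permutations_of_set {1..Suc m}" "distinct es"
proof -
  have "p \<in> permutations_of_set {1..m} \<and> set es \<subseteq> permutations_of_set {1..Suc m} \<and> distinct es"
    using assms
  proof induction
    case start
    show ?case using upt_in_permutations by simp
  next
    case (step es p i)
    then have "snoc_rank i p \<in> permutations_of_set {1..Suc m}"
      using snoc_rank_in_permutations by blast
    then show ?case using step red_tl_in_permutations by simp
  qed
  then show "p \<in> permutations_of_set {1..m}" "set es \<subseteq> permutations_of_set {1..Suc m}" "distinct es"
    by blast+
qed

text \<open>Each visit to \<open>v\<close> pairs an arrival with a departure. The start counts as an
  arrival without an edge, and the current visit to \<open>p\<close> has no departure yet.\<close>

lemma greedy_walk_balance: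
  assumes "greedy_walk m es p" "v \<in> permutations_of_set {1..m}"
  shows "card {e \<in> set es. red (tl e) = v} + (if v = [1..<Suc m] then 1 else 0) =
    card {e \<in> set es. red (butlast e) = v} + (if v = p then 1 else 0)"
  using assms(1)
proof induction
  case (step es p i)
  let ?e = "snoc_rank i p"
  have "red (butlast ?e) = p"
    using greedy_walk_wf(1)[OF step.hyps(1)] by (rule red_butlast_snoc_rank)
  moreover have "card {e \<in> set (es @ [?e]). P e} =
      card {e \<in> set es. P e} + (if P ?e then 1 else 0)" for P
  proof -
    have "{e \<in> set (es @ [?e]). P e} =
        (if P ?e then insert ?e {e \<in> set es. P e} else {e \<in> set es. P e})"
      by auto
    then show ?thesis using step.hyps(3) by simp
  qed
  ultimately show ?case using step.IH by (simp del: upt_Suc set_append add: eq_commute[of v])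
next
  case start
  show ?case by (simp del: upt_Suc)
qed

text \<open>When an edge is chosen, the smaller choices at its vertex are used already, and used
  edges stay used.\<close>

lemma greedy_walk_down_closed:
  assumes "greedy_walk m es p" "v \<in> permutations_of_set {1..m}"
    and "snoc_rank i v \<in> set es" "j \<in> {1..<i}"
  shows "snoc_rank j v \<in> set es"
  using assms(1,3)
proof induction
  case (step es p k)
  show ?case
  proof (cases "snoc_rank i v = snoc_rank k p")
    case True
    then have "i = k" "v = p"
      using snoc_rank_inject[OF assms(2) greedy_walk_wf(1)[OF step.hyps(1)]] by auto
    then show ?thesis using step.hyps(4) assms(4) by auto
  qed (use step in auto)
qed simp

text \<open>Recovers the state of the walk just before and just after its edge at position
  \<open>k\<close>.\<close>

lemma greedy_walk_take:
  assumes "greedy_walk m es p" "k < length es"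
  obtains q i where "greedy_walk m (take k es) q" "i \<in> {1..Suc m}" "es ! k = snoc_rank i q"
    "snoc_rank i q \<notin> set (take k es)" "\<forall>j\<in>{1..<i}. snoc_rank j q \<in> set (take k es)"
    "greedy_walk m (take (Suc k) es) (red (tl (es ! k)))"
  using assms
proof (induction arbitrary: thesis)
  case (step es p i)
  show ?case
  proof (cases "k < length es")
    case True
    then show ?thesis using step.IH[of thesis] step.prems(1) by (simp add: nth_append)
  next
    case False
    then have "k = length es" using step.prems by simp
    then show ?thesis
      using step.hyps step.prems(1)[of p i] greedy_walk.step[OF step.hyps] by simp
  qed
qed simp

text \<open>A balanced set of edges which, at each vertex, consists of the first \<open>d\<close> choices of the greedy
  algorithm. The last assumption says that every vertex is connected to the starting vertex by
  edges that are the last choice within this set.\<close>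

locale preferred_edges =
  fixes m :: nat and F :: "nat list set" and d :: "nat list \<Rightarrow> nat"
  assumes edges: "F \<subseteq> permutations_of_set {1..Suc m}"
    and degree: "\<And>v. v \<in> permutations_of_set {1..m} \<Longrightarrow> d v \<in> {1..Suc m}"
    and out_edges: "\<And>v i. v \<in> permutations_of_set {1..m} \<Longrightarrow> i \<in> {1..Suc m} \<Longrightarrow>
      snoc_rank i v \<in> F \<longleftrightarrow> i \<le> d v"
    and in_degree: "\<And>v. v \<in> permutations_of_set {1..m} \<Longrightarrow> card {e \<in> F. red (tl e) = v} = d v"
    and reach: "\<And>Q v. Q [1..<Suc m] \<Longrightarrow>
      (\<And>u. u \<in> permutations_of_set {1..m} \<Longrightarrow> Q (red (tl (snoc_rank (d u) u))) \<Longrightarrow> Q u) \<Longrightarrow>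
      v \<in> permutations_of_set {1..m} \<Longrightarrow> Q v"
begin

lemma finite_F: "finite F"
  using edges by (rule finite_subset) auto

lemma out_edges_eq:
  assumes "v \<in> permutations_of_set {1..m}"
  shows "{e \<in> F. red (butlast e) = v} = (\<lambda>i. snoc_rank i v) ` {1..d v}"
proof -
  have "{e \<in> F. red (butlast e) = v} = {e \<in> permutations_of_set {1..Suc m}. red (butlast e) = v} \<inter> F"
    using edges by auto
  also have "\<dots> = (\<lambda>i. snoc_rank i v) ` {1..d v}"
    unfolding edges_with_tail[OF assms] using out_edges[OF assms] degree[OF assms] by auto
  finally show ?thesis .
qed

lemma stuck_walk:
  assumes walk: "greedy_walk m es p" and sub: "set es \<subseteq> F"
    and stuck: "\<forall>i\<in>{1..d p}. snoc_rank i p \<in> set es"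
  shows "p = [1..<Suc m]" "set es = F"
proof -
  let ?V = "permutations_of_set {1..m}"
  let ?in = "\<lambda>v. {e \<in> set es. red (tl e) = v}" and ?out = "\<lambda>v. {e \<in> set es. red (butlast e) = v}"
  define full where "full v \<longleftrightarrow> (\<forall>i\<in>{1..d v}. snoc_rank i v \<in> set es)" for v
  have in_le: "card (?in v) \<le> d v" if "v \<in> ?V" for v
    unfolding in_degree[OF that, symmetric] using sub finite_F by (intro card_mono) auto
  have full_out: "card (?out v) = d v" if "v \<in> ?V" "full v" for v
  proof -
    have "?out v = {e \<in> F. red (butlast e) = v}"
      using sub that unfolding full_def out_edges_eq[OF that(1)]
      using out_edges_eq[OF that(1)] by auto
    then show ?thesis
      unfolding out_edges_eq[OF that(1)]
      by (simp add: card_image inj_on_subset[OF inj_snoc_rank])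
  qed
  note wf = greedy_walk_wf[OF walk]
  have "full p" using stuck by (simp add: full_def)
  \<comment> \<open>Away from the start, arrivals at \<open>p\<close> would exceed departures by
    one, but the departures already number \<open>d p\<close>, the bound for arrivals.\<close>
  show p: "p = [1..<Suc m]"
  proof (rule ccontr)
    assume "p \<noteq> [1..<Suc m]"
    then have "card (?in p) = Suc (card (?out p))"
      using greedy_walk_balance[OF walk wf(1)] by simp
    then show False using full_out[OF wf(1) \<open>full p\<close>] in_le[OF wf(1)] by simp
  qed
  \<comment> \<open>The walk is closed now, so a full vertex has \<open>d v\<close> used edges
    entering it, which are all that \<open>F\<close> has.\<close>
  have full_in: "e \<in> set es" if "v \<in> ?V" "full v" "e \<in> F" "red (tl e) = v" for v e
  proof -
    have "card (?in v) = card {e \<in> F. red (tl e) = v}"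
      using greedy_walk_balance[OF walk that(1)] full_out[OF that(1,2)] in_degree[OF that(1)] p
      by (simp del: upt_Suc)
    then have "?in v = {e \<in> F. red (tl e) = v}"
      using sub finite_F by (intro card_subset_eq) auto
    then show ?thesis using that by auto
  qed
  \<comment> \<open>Fullness passes backwards along last choices: such an edge enters a full vertex,
    hence is used, and the smaller choices were used before it.\<close>
  have all_full: "full v" if "v \<in> ?V" for v
  proof (rule reach[OF _ _ that])
    show "full [1..<Suc m]" using \<open>full p\<close> p by simp
  next
    fix u assume u: "u \<in> ?V" and f: "full (red (tl (snoc_rank (d u) u)))"
    have "snoc_rank (d u) u \<in> F" using out_edges[OF u] degree[OF u] by simp
    moreover have "red (tl (snoc_rank (d u) u)) \<in> ?V"
      using red_tl_in_permutations snoc_rank_in_permutations[OF u degree[OF u]] .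
    ultimately have last: "snoc_rank (d u) u \<in> set es" using full_in f by blast
    show "full u" unfolding full_def
    proof
      fix i assume i: "i \<in> {1..d u}"
      show "snoc_rank i u \<in> set es"
        using last greedy_walk_down_closed[OF walk u last, of i] i by (cases "i = d u") auto
    qed
  qed
  show "set es = F"
  proof
    show "F \<subseteq> set es"
    proof
      fix e assume e: "e \<in> F"
      then have v: "red (butlast e) \<in> ?V" using edges permutation_eq_snoc_rank by (metis subsetD)
      then have "e \<in> (\<lambda>i. snoc_rank i (red (butlast e))) ` {1..d (red (butlast e))}"
        using e out_edges_eq[OF v] by blast
      then show "e \<in> set es" using all_full[OF v] by (auto simp: full_def)
    qed
  qed (rule sub)
qed

end

section \<open>Connection to the starting vertex\<close>

declare upt_Suc [simp del]

lemma red_strict_sorted: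
  assumes "sorted_wrt (<) w"
  shows "red w = [1..<Suc (length w)]"
proof -
  have "distinct w" using assms by (simp add: strict_sorted_iff)
  then have p: "red w \<in> permutations_of_set {1..length w}" by (rule red_in_permutations)
  have "sorted_wrt (<) (red w)"
    using assms strict_mono_onD[OF strict_mono_on_rank, of _ w]
    unfolding red_def sorted_wrt_map by (rule sorted_wrt_mono_rel[rotated]) auto
  then have "sorted (red w)" by (simp add: strict_sorted_iff)
  moreover have "set (red w) = set [1..<Suc (length w)]"
    using permutations_of_setD(1)[OF p] by (simp add: atLeastLessThanSuc_atLeastAtMost)
  ultimately show ?thesis
    using permutations_of_setD(2)[OF p] by (intro sorted_distinct_set_unique) simp_all
qed

text \<open>Appending a new maximum \<open>m\<close> times replaces the window by an increasing
  word. \<open>W k\<close> is the unreduced window after \<open>k\<close> steps; the induction runs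
  down from \<open>k = m\<close> because \<open>Q\<close> is pulled back along edges.\<close>

lemma reach_by_maximum:
  assumes start: "Q [1..<Suc m]"
    and prev: "\<And>u. u \<in> permutations_of_set {1..m} \<Longrightarrow> Q (red (tl (snoc_rank (Suc m) u))) \<Longrightarrow> Q u"
    and v: "v \<in> permutations_of_set {1..m}"
  shows "Q v"
proof -
  have vs: "set v = {1..m}" "distinct v" using permutations_of_setD[OF v] by auto
  have len: "length v = m" using length_finite_permutations_of_set[OF v] by simp
  define W where "W k = drop k v @ [Suc m..<Suc m + k]" for k
  have "Q (red (W k))" if "k \<le> m" for k
    using that
  proof (induction rule: inc_induct)
    case base
    have "W m = [Suc m..<Suc m + m]" using len by (simp add: W_def)
    then have "red (W m) = [1..<Suc m]" using red_strict_sorted[of "W m"] by simp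
    then show ?case using start by simp
  next
    case (step k)
    have dk: "set (drop k v) \<subseteq> {1..m}" using vs set_drop_subset[of k v] by simp
    have lt: "\<forall>x\<in>set (W k). x < Suc m + k" using dk by (auto simp: W_def)
    have lenW: "length (W k) = m" using step.hyps len by (simp add: W_def)
    have dist: "distinct (W k)" using vs dk by (auto simp: W_def)
    have "{x \<in> set (W k). x < Suc m + k} = set (W k)" using lt by blast
    then have i: "Suc m = Suc (card {x \<in> set (W k). x < Suc m + k})"
      using distinct_card[OF dist] lenW by simp
    have "drop k v \<noteq> []" using step.hyps len by simp
    then have "tl (W k) @ [Suc m + k] = W (Suc k)" by (simp add: W_def drop_Suc tl_drop upt_Suc)
    moreover have "Suc m + k \<notin> set (W k)" using lt by blast
    moreover have "W k \<noteq> []" using lenW step.hyps by auto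
    ultimately have "red (tl (snoc_rank (Suc m) (red (W k)))) = red (W (Suc k))"
      using red_tl_snoc_rank[OF _ _ i] by simp
    then show ?case using prev red_in_permutations[OF dist] lenW step.IH by simp
  qed
  from this[of 0] show ?thesis using red_permutation[OF v] by (simp add: W_def)
qed

text \<open>The maximum \<open>M\<close> gets rank \<open>length (xs @ M # ys)\<close>, the minimum
  \<open>l\<close> gets rank 1, and taking ranks preserves the order of occurrence.\<close>

lemma occurs_before_red:
  assumes "distinct (xs @ M # ys)" "\<forall>x\<in>set xs \<union> set ys. x < M"
    and "l \<in> set ys" "\<forall>x\<in>set xs \<union> set ys. l \<le> x"
  shows "occurs_before (red (xs @ M # ys)) (length (xs @ M # ys)) 1"
proof -
  let ?u = "xs @ M # ys"
  let ?r = "\<lambda>x. card {y \<in> set ?u. y \<le> x}"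
  have "{y \<in> set ?u. y \<le> M} = set ?u" using assms(2) by (auto simp: less_imp_le)
  then have M: "?r M = length ?u" using distinct_card[OF assms(1)] by simp
  have "l < M" using assms(2,3) by auto
  then have "{y \<in> set ?u. y \<le> l} = {l}" using assms(3,4) by (auto dest: bspec intro: le_antisym)
  then have l: "?r l = 1" by simp
  have "occurs_before ?u M l" using assms(3) by (simp add: occurs_before_append)
  then have "occurs_before (map ?r ?u) (?r M) (?r l)" by (rule occurs_before_mapI)
  then show ?thesis unfolding M l by (simp only: red_def)
qed

lemma not_occurs_before_red_snoc:
  assumes "distinct z" "z \<noteq> []" "\<forall>x\<in>set z. x < A"
  shows "\<not> occurs_before (red (z @ [A])) (Suc (length z)) 1"
proof -
  have "{x \<in> set z. x < A} = set z" using assms(3) by blast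
  then have "red (z @ [A]) = snoc_rank (Suc (length z)) (red z)"
    using red_snoc[of A z] assms distinct_card[OF assms(1)] by fastforce
  then show ?thesis
    using occurs_before_snoc_rank[OF red_in_permutations[OF assms(1)], of "Suc (length z)"] assms(2)
    by (simp add: Suc_le_eq)
qed

text \<open>\<open>Q\<close> holds at the start and is pulled back along the last preferred choices:
  the new letter goes just below the maximum if the maximum precedes the minimum, and below all
  letters otherwise.\<close>

context
  fixes m :: nat and Q :: "nat list \<Rightarrow> bool"
  assumes m: "2 \<le> m"
    and start: "Q [1..<Suc m]"
    and prev: "\<And>u. u \<in> permutations_of_set {1..m} \<Longrightarrow>
      Q (red (tl (snoc_rank (if occurs_before u m 1 then m else 1) u))) \<Longrightarrow> Q u"
begin

text \<open>Once the maximum \<open>M\<close> is replaced by \<open>M + m\<close>, the letters appended just below the maximum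
  can be taken to be \<open>M, M + 1, \<dots>\<close>; this goes on until the maximum leaves the window.\<close>

lemma reach_max_before_min:
  assumes dist: "distinct (xs @ M # ys)" and len: "length (xs @ M # ys) = m"
    and max: "\<forall>x\<in>set xs \<union> set ys. x < M"
    and l: "l \<in> set ys" "\<forall>x\<in>set xs \<union> set ys. l \<le> x"
    and Q: "Q (red (ys @ [M..<Suc (M + length xs)]))"
  shows "Q (red (xs @ M # ys))"
proof -
  define W where "W k = drop k xs @ (M + m) # ys @ [M..<M + k]" for k
  have sub: "set (drop k xs) \<subseteq> set xs" for k by (rule set_drop_subset)
  have pull: "Q (red (W k))" if "Q (red (tl (W k) @ [M + k]))" "k \<le> length xs" for k
  proof -
    have km: "k < m" using that(2) len by simp
    have lt: "x < M" if "x \<in> set (drop k xs) \<or> x \<in> set ys" for x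
      using that max sub[of k] by blast
    have set_W: "x \<in> set (W k) \<longleftrightarrow>
        x \<in> set (drop k xs) \<or> x \<in> set ys \<or> x = M + m \<or> M \<le> x \<and> x < M + k" for x
      by (auto simp: W_def)
    have "set (drop k xs) \<inter> set ys = {}" using dist sub[of k] by auto
    then have dW: "distinct (W k)"
      using dist km by (auto simp: W_def dest: lt[OF disjI1] lt[OF disjI2])
    have lW: "length (W k) = m" using that(2) len by (simp add: W_def)
    have "l < M" using max l by auto
    have "occurs_before (red (W k)) (length (W k)) 1"
      unfolding W_def
    proof (rule occurs_before_red)
      show "distinct (drop k xs @ (M + m) # ys @ [M..<M + k])" using dW by (simp add: W_def)
      show "\<forall>x\<in>set (drop k xs) \<union> set (ys @ [M..<M + k]). x < M + m"
        using km by (auto dest!: lt[OF disjI1] lt[OF disjI2])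
      show "\<forall>x\<in>set (drop k xs) \<union> set (ys @ [M..<M + k]). l \<le> x"
        using l sub[of k] \<open>l < M\<close> by auto
    qed (use l in simp)
    then have ob: "occurs_before (red (W k)) m 1" using lW by simp
    have "M + m \<in> set (W k)" by (simp add: W_def)
    \<comment> \<open>Only the maximum lies above \<open>M + k\<close>, so the new letter has rank
      \<open>m\<close>, the last preferred choice here.\<close>
    moreover have "{x \<in> set (W k). x < M + k} = set (W k) - {M + m}"
    proof (rule set_eqI)
      fix x show "x \<in> {x \<in> set (W k). x < M + k} \<longleftrightarrow> x \<in> set (W k) - {M + m}"
        using lt[of x] km by (auto simp: set_W)
    qed
    ultimately have i: "m = Suc (card {x \<in> set (W k). x < M + k})"
      using distinct_card[OF dW] lW m by simp
    have "M + k \<notin> set (W k)" using km by (auto simp: set_W dest!: lt[OF disjI1] lt[OF disjI2])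
    moreover have "W k \<noteq> []" by (simp add: W_def)
    ultimately have "red (tl (snoc_rank m (red (W k)))) = red (tl (W k) @ [M + k])"
      using i by (rule red_tl_snoc_rank)
    then show ?thesis using prev[of "red (W k)"] red_in_permutations[OF dW] lW ob that(1) by simp
  qed
  have "Q (red (W k))" if "k \<le> length xs" for k
    using that
  proof (induction rule: inc_induct)
    case base
    show ?case using pull[of "length xs"] Q by (simp add: W_def upt_Suc)
  next
    case (step k)
    have "drop k xs \<noteq> []" using step.hyps by simp
    then have "tl (W k) @ [M + k] = W (Suc k)" by (simp add: W_def drop_Suc tl_drop upt_Suc)
    then show ?case using pull[of k] step by simp
  qed
  from this[of 0] have "Q (red (xs @ (M + m) # ys))" by (simp add: W_def)
  \<comment> \<open>Raising the maximum keeps the relative order, so the window starting with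
    \<open>W 0\<close> represents the original vertex.\<close>
  moreover have "red (map (\<lambda>x. if x = M then M + m else x) (xs @ M # ys)) = red (xs @ M # ys)"
  proof (rule red_map_strict_mono, rule strict_mono_onI)
    fix r s assume rs: "r \<in> set (xs @ M # ys)" "s \<in> set (xs @ M # ys)" "r < s"
    have "r \<le> M" "s \<le> M" using rs max by (auto simp: less_imp_le)
    then show "(if r = M then M + m else r) < (if s = M then M + m else s)" using rs(3) by simp
  qed
  moreover have "map (\<lambda>x. if x = M then M + m else x) zs = zs" if "M \<notin> set zs" for zs
    by (rule map_idI) (use that in auto)
  then have "map (\<lambda>x. if x = M then M + m else x) (xs @ M # ys) = xs @ (M + m) # ys"
    using dist by simp
  ultimately show ?thesis by simp
qed

text \<open>A last maximum makes 1 the last preferred choice, which appends a new minimum behind the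
  maximum. By \<open>reach_max_before_min\<close> the window then becomes this minimum followed by
  increasing letters, which is the start.\<close>

lemma reach_max_last:
  assumes dist: "distinct (z @ [A])" and len: "length (z @ [A]) = m" and max: "\<forall>x\<in>set z. x < A"
  shows "Q (red (z @ [A]))"
proof -
  \<comment> \<open>Raising all letters by one frees 0 for the new minimum.\<close>
  let ?z = "map Suc z"
  have z: "z \<noteq> []" "length z = m - 1" using len m by auto
  have dz: "distinct (?z @ [Suc A])" using dist by (auto simp: distinct_map)
  have red: "red (?z @ [Suc A]) = red (z @ [A])"
    using red_map_strict_mono[of "z @ [A]" Suc] by (simp add: strict_mono_on_def)
  have ob: "\<not> occurs_before (red (?z @ [Suc A])) m 1"
    using not_occurs_before_red_snoc[of ?z "Suc A"] dz z max m by simp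
  have "red ([0] @ [Suc A..<Suc (Suc A + length (tl ?z))]) = [1..<Suc m]"
    using red_strict_sorted[of "[0] @ [Suc A..<Suc (Suc A + length (tl ?z))]"] z m by simp
  moreover have "set (tl ?z) \<subseteq> set ?z" by (cases z) auto
  moreover have "distinct (tl ?z)" using dz by (simp add: distinct_tl)
  ultimately have "Q (red (tl ?z @ Suc A # [0]))"
    using start max dz z m by (intro reach_max_before_min[where l = 0]) auto
  moreover have "red (tl (snoc_rank 1 (red (?z @ [Suc A])))) = red (tl (?z @ [Suc A]) @ [0])"
    by (rule red_tl_snoc_rank) auto
  ultimately have "Q (red (?z @ [Suc A]))"
    using prev[of "red (?z @ [Suc A])"] ob red_in_permutations[OF dz] z m by simp
  then show ?thesis using red by simp
qed

text \<open>If the maximum precedes the minimum, the walk continues until the maximum leaves the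
  window; the last letter is then the new maximum, as \<open>reach_max_last\<close> requires.
  Otherwise one new minimum, written 0, leads to this case.\<close>

lemma reach_by_last_choice:
  assumes v: "v \<in> permutations_of_set {1..m}"
  shows "Q v"
proof -
  have vs: "set v = {1..m}" "distinct v" using permutations_of_setD[OF v] by auto
  have len: "length v = m" using length_finite_permutations_of_set[OF v] by simp
  have main: "Q (red (xs @ m # ys))"
    if d: "distinct (xs @ m # ys)" and ln: "length (xs @ m # ys) = m"
      and max: "\<forall>x\<in>set xs \<union> set ys. x < m"
      and l: "l \<in> set ys" "\<forall>x\<in>set xs \<union> set ys. l \<le> x" for xs ys l
  proof (rule reach_max_before_min[OF d ln max l])
    have "Q (red ((ys @ [m..<m + length xs]) @ [m + length xs]))"
    proof (rule reach_max_last)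
      show "distinct ((ys @ [m..<m + length xs]) @ [m + length xs])"
        using d max by (auto dest: bspec)
      show "\<forall>x\<in>set (ys @ [m..<m + length xs]). x < m + length xs"
        using max by (auto simp: trans_less_add1)
    qed (use ln in simp)
    then show "Q (red (ys @ [m..<Suc (m + length xs)]))" by (simp add: upt_Suc)
  qed
  show ?thesis
  proof (cases "occurs_before v m 1")
    case True
    then obtain xs ys where v_eq: "v = xs @ m # ys"
      by (meson occurs_before_in_set split_list)
    have d: "distinct (xs @ m # ys)" using vs v_eq by simp
    have mem: "x \<in> {1..m}" "x \<noteq> m" if "x \<in> set xs \<union> set ys" for x
      using that vs v_eq by auto
    have "1 \<in> set ys"
      using True d m unfolding v_eq by (auto simp: occurs_before_append dest: occurs_before_in_set)
    then have "Q (red v)"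
      unfolding v_eq using d len v_eq mem by (intro main[where l = 1]) (fastforce simp: le_less)+
    then show ?thesis using red_permutation[OF v] by simp
  next
    case False
    obtain a t where v_eq: "v = a # t" using len m by (cases v) auto
    \<comment> \<open>A maximum in first place would precede 1; hence the maximum survives the
      deletion of the first letter.\<close>
    have "a \<noteq> m"
    proof
      assume "a = m"
      then have "1 \<in> set t" using vs m v_eq by (metis atLeastAtMost_iff le_refl numeral_le_one_iff
          one_le_numeral order_trans semiring_norm(69) set_ConsD)
      then show False using False v_eq \<open>a = m\<close> by simp
    qed
    then have "m \<in> set t" using vs m v_eq by (metis atLeastAtMost_iff le_refl one_le_numeral
          order_trans set_ConsD)
    then obtain xs ys where t: "t = xs @ m # ys" by (meson split_list)
    have mem: "x \<in> {1..m}" "x \<noteq> m" if "x \<in> set xs \<union> set ys" for x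
      using that vs v_eq t by auto
    have "Q (red (xs @ m # ys @ [0]))"
    proof (rule main[where l = 0])
      show "distinct (xs @ m # ys @ [0])" using vs v_eq t mem m by auto
      show "length (xs @ m # ys @ [0]) = m" using len v_eq t by simp
      show "\<forall>x\<in>set xs \<union> set (ys @ [0]). x < m" using mem m by (fastforce simp: le_less)
    qed auto
    moreover have "0 \<notin> set v" using vs by simp
    then have "red (tl (snoc_rank 1 (red v))) = red (tl v @ [0])"
      by (rule red_tl_snoc_rank) (use v_eq in auto)
    then have "red (tl (snoc_rank 1 v)) = red (xs @ m # ys @ [0])"
      using red_permutation[OF v] by (simp add: v_eq t)
    ultimately show ?thesis using prev[OF v] False by simp
  qed
qed

end

section \<open>The two balanced sets of edges\<close>

lemma card_in_edges:
  assumes v: "v \<in> permutations_of_set {1..m}"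
  shows "card {e \<in> permutations_of_set {1..Suc m}. P e \<and> red (tl e) = v} =
    card {i \<in> {1..Suc m}. P (cons_rank i v)}"
proof -
  have "{e \<in> permutations_of_set {1..Suc m}. P e \<and> red (tl e) = v} =
      {e \<in> permutations_of_set {1..Suc m}. red (tl e) = v} \<inter> {e. P e}"
    by blast
  also have "\<dots> = (\<lambda>i. cons_rank i v) ` {i \<in> {1..Suc m}. P (cons_rank i v)}"
    unfolding edges_with_head[OF v] by blast
  finally show ?thesis by (simp add: card_image inj_on_subset[OF inj_cons_rank])
qed

lemma preferred_edges_all:
  "preferred_edges m (permutations_of_set {1..Suc m}) (\<lambda>_. Suc m)"
proof
  fix v assume v: "v \<in> permutations_of_set {1..m}"
  show "card {e \<in> permutations_of_set {1..Suc m}. red (tl e) = v} = Suc m"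
    using card_in_edges[OF v, of "\<lambda>_. True"] by (simp del: atLeastAtMost_iff)
  fix i assume "i \<in> {1..Suc m}"
  then show "snoc_rank i v \<in> permutations_of_set {1..Suc m} \<longleftrightarrow> i \<le> Suc m"
    using snoc_rank_in_permutations[OF v] by simp
next
  fix Q v
  assume "Q [1..<Suc m]" "v \<in> permutations_of_set {1..m}"
    and "\<And>u. u \<in> permutations_of_set {1..m} \<Longrightarrow> Q (red (tl (snoc_rank (Suc m) u))) \<Longrightarrow> Q u"
  then show "Q v" using reach_by_maximum by blast
qed auto

text \<open>If \<open>v\<close> has its maximum before its minimum, the last entries
  \<open>1..m\<close> leave it and the first entries \<open>2..Suc m\<close> enter it; otherwise
  only the last entry 1 and the first entry \<open>Suc m\<close>. So in-degrees and out-degrees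
  agree.\<close>

lemma preferred_edges_max_before_min:
  assumes m: "2 \<le> m"
  shows "preferred_edges m (perms_before (Suc m) (Suc m) 1)
    (\<lambda>v. if occurs_before v m 1 then m else 1)"
proof
  show "perms_before (Suc m) (Suc m) 1 \<subseteq> permutations_of_set {1..Suc m}"
    by (auto simp: perms_before_eq)
next
  fix v assume v: "v \<in> permutations_of_set {1..m}"
  show "(if occurs_before v m 1 then m else 1) \<in> {1..Suc m}" using m by simp
  have "{i \<in> {1..Suc m}. occurs_before (cons_rank i v) (Suc m) 1} =
      {i \<in> {1..Suc m}. i = Suc m \<or> 2 \<le> i \<and> occurs_before v m 1}"
    using occurs_before_cons_rank[OF v] m by (intro Collect_cong conj_cong) auto
  also have "\<dots> = (if occurs_before v m 1 then {2..Suc m} else {Suc m})" using m by auto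
  finally show "card {e \<in> perms_before (Suc m) (Suc m) 1. red (tl e) = v} =
      (if occurs_before v m 1 then m else 1)"
    using card_in_edges[OF v, of "\<lambda>e. occurs_before e (Suc m) 1"]
    by (simp add: perms_before_eq conj_ac)
  fix i assume i: "i \<in> {1..Suc m}"
  show "snoc_rank i v \<in> perms_before (Suc m) (Suc m) 1 \<longleftrightarrow>
      i \<le> (if occurs_before v m 1 then m else 1)"
    using occurs_before_snoc_rank[OF v i] snoc_rank_in_permutations[OF v i] i m
    by (auto simp: perms_before_eq)
next
  fix Q v
  assume "Q [1..<Suc m]" "v \<in> permutations_of_set {1..m}"
    and "\<And>u. u \<in> permutations_of_set {1..m} \<Longrightarrow>
      Q (red (tl (snoc_rank (if occurs_before u m 1 then m else 1) u))) \<Longrightarrow> Q u"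
  then show "Q v" using reach_by_last_choice[OF m, of Q] by blast
qed

section \<open>The order of the edges\<close>

lemma greedy_walk_snocD:
  assumes "greedy_walk m (es @ [e]) q"
  shows "q = red (tl e)"
  using assms by (cases rule: greedy_walk.cases) auto

text \<open>The first edge that the walk takes outside the preferred set;
  \<open>red_rotated_upt\<close> gives the vertex to which it leads.\<close>

lemma snoc_rank_2_upt:
  assumes "2 \<le> m"
  shows "snoc_rank 2 [1..<Suc m] = 1 # [3..<Suc (Suc m)] @ [2]"
proof -
  have "[1..<Suc m] = 1 # [2..<Suc m]" using assms by (simp add: upt_conv_Cons numeral_2_eq_2)
  moreover have "map (shift 2) [2..<Suc m] = map Suc [2..<Suc m]"
    by (rule map_cong) (auto simp: shift_def)
  moreover have "map Suc [2..<Suc m] = [3..<Suc (Suc m)]"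
    by (simp add: map_Suc_upt numeral_3_eq_3 numeral_2_eq_2)
  ultimately show ?thesis by (simp add: snoc_rank_def shift_def)
qed

lemma red_rotated_upt:
  assumes "2 \<le> m"
  shows "red ([3..<Suc (Suc m)] @ [2]) = [2..<Suc m] @ [1]"
proof -
  have "[2..<Suc m] @ [1] \<in> permutations_of_set {1..m}"
    using assms by (auto simp: permutations_of_set_def)
  then have "red ([2..<Suc m] @ [1]) = [2..<Suc m] @ [1]" by (rule red_permutation)
  moreover have "map Suc ([2..<Suc m] @ [1]) = [3..<Suc (Suc m)] @ [2]"
    by (simp add: map_Suc_upt numeral_3_eq_3 numeral_2_eq_2)
  moreover have "red (map Suc ([2..<Suc m] @ [1])) = red ([2..<Suc m] @ [1])"
    by (rule red_map_strict_mono) (simp add: strict_mono_on_def)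
  ultimately show ?thesis by metis
qed

lemma greedy_walk_halves:
  assumes m: "2 \<le> m" and walk: "greedy_walk m es p"
    and all: "set es = permutations_of_set {1..Suc m}"
  defines "N \<equiv> fact (Suc m) div 2"
  shows "length es = fact (Suc m)"
    and "set (take N es) = perms_before (Suc m) (Suc m) 1"
    and "es ! (N - 1) = Suc m # [1..<Suc m]"
    and "es ! N = 1 # [3..<Suc (Suc m)] @ [2]"
    and "es ! Suc N = [2..<Suc m] @ [1, Suc m]"
proof -
  let ?F = "perms_before (Suc m) (Suc m) 1"
  let ?v0 = "[1..<Suc m]"
  let ?d = "\<lambda>v. if occurs_before v m 1 then m else 1"
  interpret F: preferred_edges m ?F ?d by (rule preferred_edges_max_before_min[OF m])
  have dist: "distinct es" using greedy_walk_wf(3)[OF walk] .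
  show len: "length es = fact (Suc m)"
    using distinct_card[OF dist] all by (simp del: fact_Suc)
  have v0: "?v0 \<in> permutations_of_set {1..m}" by (rule upt_in_permutations)
  have not_ob: "\<not> occurs_before ?v0 m 1"
    using not_occurs_before_red_snoc[of "[1..<m]" m] m red_permutation[OF v0]
    by (simp add: upt_Suc)
  have "snoc_rank (Suc m) ?v0 \<notin> ?F" using F.out_edges[OF v0, of "Suc m"] not_ob m by auto
  moreover have "snoc_rank (Suc m) ?v0 \<in> set es"
    unfolding all using snoc_rank_in_permutations[OF v0, of "Suc m"] by simp
  ultimately have ex: "\<exists>e\<in>set es. e \<notin> ?F" by blast
  \<comment> \<open>The position of the first edge outside \<open>?F\<close>. Just before it the
    walk is stuck within \<open>?F\<close>, so it has used exactly \<open>?F\<close>.\<close>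
  define k where "k = length (takeWhile (\<lambda>e. e \<in> ?F) es)"
  have k: "k < length es"
  proof (rule ccontr)
    assume "\<not> k < length es"
    then have "takeWhile (\<lambda>e. e \<in> ?F) es = es"
      unfolding k_def by (metis not_less take_all takeWhile_eq_take)
    then show False using ex unfolding takeWhile_eq_all_conv by blast
  qed
  have notF: "es ! k \<notin> ?F" using nth_length_takeWhile k unfolding k_def by blast
  have sub: "set (take k es) \<subseteq> ?F"
    unfolding k_def by (metis set_takeWhileD subsetI takeWhile_eq_take)
  obtain q i where q: "greedy_walk m (take k es) q" "i \<in> {1..Suc m}" "es ! k = snoc_rank i q"
    "\<forall>j\<in>{1..<i}. snoc_rank j q \<in> set (take k es)"
    "greedy_walk m (take (Suc k) es) (red (tl (es ! k)))"
    using greedy_walk_take[OF walk k] by metis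
  have "?d q < i"
    using F.out_edges[OF greedy_walk_wf(1)[OF q(1)] q(2)] notF q(3) by (metis not_le)
  then have stuck: "\<forall>j\<in>{1..?d q}. snoc_rank j q \<in> set (take k es)" using q(4) by auto
  have q_eq: "q = ?v0" and F_eq: "set (take k es) = ?F"
    using F.stuck_walk[OF q(1) sub stuck] by blast+
  have "length (take k es) = card ?F"
    using distinct_card[of "take k es"] dist F_eq by simp
  then have kN: "k = N" using k card_perms_before[of "Suc m"] m unfolding N_def by simp
  show set_take: "set (take N es) = ?F" using F_eq kN by simp
  \<comment> \<open>At the start only the last entry 1 lies in \<open>?F\<close>. A choice above 2
    would require the edge with last entry 2 among the used ones, which are all in
    \<open>?F\<close>.\<close>
  have "i = 2"
  proof (rule ccontr)
    assume "i \<noteq> 2"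
    then have "2 \<in> {1..<i}" using \<open>?d q < i\<close> not_ob q_eq by simp
    then have "snoc_rank 2 ?v0 \<in> ?F" using q(4) F_eq q_eq by blast
    then show False using F.out_edges[OF v0, of 2] not_ob m by simp
  qed
  then show esN: "es ! N = 1 # [3..<Suc (Suc m)] @ [2]"
    using q(3) q_eq kN snoc_rank_2_upt[OF m] by simp
  have "(6::nat) = fact 3" by (simp add: numeral_3_eq_3)
  also have "\<dots> \<le> fact (Suc m)" using m by (intro fact_mono_nat) simp
  finally have fact6: "6 \<le> (fact (Suc m) :: nat)" .
  have N: "1 \<le> N" "Suc N < length es" unfolding len N_def using fact6 by linarith+
  show "es ! (N - 1) = Suc m # [1..<Suc m]"
  proof -
    let ?e = "es ! (N - 1)"
    have "take N es = take (N - 1) es @ [?e]"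
      using N take_Suc_conv_app_nth[of "N - 1" es] by simp
    \<comment> \<open>The last edge within \<open>?F\<close> enters the start, where only the first
      entry \<open>Suc m\<close> puts the maximum before the minimum.\<close>
    then have head: "red (tl ?e) = ?v0" using greedy_walk_snocD q(1) kN q_eq by metis
    have "?e \<in> set (take N es)" using \<open>take N es = _\<close> by simp
    then have e: "?e \<in> permutations_of_set {1..Suc m}" "occurs_before ?e (Suc m) 1"
      using set_take by (auto simp: perms_before_eq)
    have e_eq: "?e = cons_rank (hd ?e) ?v0" using permutation_eq_cons_rank(2)[OF e(1)] head by simp
    then have "hd ?e = Suc m"
      using occurs_before_cons_rank[OF v0 permutation_eq_cons_rank(1)[OF e(1)]] e(2) not_ob m by simp
    moreover have "map (shift (Suc m)) ?v0 = ?v0" by (rule map_idI) (auto simp: shift_def)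
    ultimately show ?thesis using e_eq by (simp add: cons_rank_def)
  qed
  show "es ! Suc N = [2..<Suc m] @ [1, Suc m]"
  proof -
    let ?q = "[2..<Suc m] @ [1]"
    obtain r j where r: "greedy_walk m (take (Suc N) es) r" "j \<in> {1..Suc m}"
      "es ! Suc N = snoc_rank j r" "snoc_rank j r \<notin> set (take (Suc N) es)"
      using greedy_walk_take[OF walk N(2)] by metis
    have "take (Suc N) es = take N es @ [es ! N]" using N by (intro take_Suc_conv_app_nth) simp
    then have "r = red (tl (es ! N))" using greedy_walk_snocD r(1) by metis
    then have r_eq: "r = ?q" using esN red_rotated_upt[OF m] by simp
    have "set (take N es) \<subseteq> set (take (Suc N) es)" by (rule set_take_subset_set_take) simp
    then have "snoc_rank j r \<notin> ?F" using r(4) set_take by blast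
    \<comment> \<open>At this vertex every last entry except \<open>Suc m\<close> gives an edge of
      \<open>?F\<close>, and these are used up.\<close>
    moreover have "occurs_before r m 1" using m by (simp add: r_eq occurs_before_append)
    ultimately have "j = Suc m"
      using F.out_edges[OF greedy_walk_wf(1)[OF r(1)] r(2)] r(2) by simp
    moreover have "map (shift (Suc m)) ?q = ?q" by (rule map_idI) (use m in \<open>auto simp: shift_def\<close>)
    ultimately show ?thesis using r(3) r_eq by (simp add: snoc_rank_def)
  qed
qed

section \<open>The greedy algorithm as a walk\<close>

text \<open>Kept in order of position, to serve as the edge list of the walk. Truncated subtraction
  makes the list empty for words shorter than \<open>n\<close>, in particular for the initial
  word.\<close>

definition patterns :: "nat \<Rightarrow> nat list \<Rightarrow> nat list list" where
  "patterns n w = map (\<lambda>k. red (take n (drop k w))) [0..<Suc (length w) - n]"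

definition window :: "nat \<Rightarrow> nat list \<Rightarrow> nat list" where
  "window m w = drop (length w - m) w"

lemma set_patterns: "set (patterns n w) = {red u |u. sublist u w \<and> length u = n}"
proof (intro set_eqI iffI)
  fix e assume "e \<in> set (patterns n w)"
  then obtain k where k: "k < Suc (length w) - n" "e = red (take n (drop k w))"
    by (auto simp: patterns_def)
  have "sublist (take n (drop k w)) w"
    by (meson sublist_drop sublist_order.order_trans sublist_take)
  moreover have "length (take n (drop k w)) = n" using k by simp
  ultimately show "e \<in> {red u |u. sublist u w \<and> length u = n}" using k by blast
next
  fix e assume "e \<in> {red u |u. sublist u w \<and> length u = n}"
  then obtain ps u ss where u: "e = red u" "length u = n" "w = ps @ u @ ss"
    by (auto simp: sublist_def)
  then have "e = red (take n (drop (length ps) w))" "length ps < Suc (length w) - n" by auto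
  then show "e \<in> set (patterns n w)" by (auto simp: patterns_def)
qed

text \<open>Renumbering preserves the old patterns, so a step only adds the pattern of the new last
  factor.\<close>

lemma patterns_snoc:
  assumes "m \<le> length w"
  shows "patterns (Suc m) (map (shift b) w @ [b]) =
    patterns (Suc m) w @ [red (map (shift b) (window m w) @ [b])]"
proof -
  let ?l = "length w - m"
  have "red (take (Suc m) (drop k (map (shift b) w @ [b]))) = red (take (Suc m) (drop k w))"
    if "k < ?l" for k
  proof -
    have "take (Suc m) (drop k (map (shift b) w @ [b])) = map (shift b) (take (Suc m) (drop k w))"
      using that by (simp add: drop_map take_map)
    then show ?thesis by (simp add: red_map_strict_mono strict_mono_on_shift)
  qed
  moreover have "take (Suc m) (drop ?l (map (shift b) w @ [b])) = map (shift b) (window m w) @ [b]"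
    using assms by (simp add: drop_map window_def)
  then have "red (take (Suc m) (drop ?l (map (shift b) w @ [b]))) =
      red (map (shift b) (window m w) @ [b])"
    by (rule arg_cong)
  moreover have "[0..<Suc (length (map (shift b) w @ [b])) - Suc m] = [0..<?l] @ [?l]"
    using assms by (simp add: Suc_diff_le upt_Suc)
  ultimately show ?thesis unfolding patterns_def by (simp del: take_append drop_append)
qed

lemma window_snoc:
  assumes "1 \<le> m" "m \<le> length w"
  shows "window m (map (shift b) w @ [b]) = tl (map (shift b) (window m w) @ [b])"
proof -
  have "Suc (length w) - m = Suc (length w - m)" using assms by simp
  moreover have "window m w \<noteq> []" using assms by (simp add: window_def)
  ultimately show ?thesis
    using assms by (simp add: window_def drop_Suc tl_drop[symmetric] map_tl drop_map)
qed

lemma admissible_iff: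
  assumes "distinct w" "\<forall>x\<in>set w. 1 \<le> x" "1 \<le> m" "m \<le> length w"
  shows "admissible (Suc m) w i \<longleftrightarrow>
    i \<in> {1..Suc m} \<and> snoc_rank i (red (window m w)) \<notin> set (patterns (Suc m) w)"
proof -
  let ?v = "window m w"
  have v: "distinct ?v" "?v \<noteq> []" "length ?v = m" "\<forall>x\<in>set ?v. 1 \<le> x"
    using assms by (auto simp: window_def dest: in_set_dropD)
  have "red (extension i ?v) = snoc_rank i (red ?v)" if "i \<in> {1..Suc m}"
    using red_extension[OF v(1,2) _ v(4)] v(3) that by simp
  then show ?thesis
    unfolding admissible_def set_patterns by (auto simp: window_def[symmetric])
qed

text \<open>While all patterns have their maximum before their minimum, the letter 1 never leaves the
  window; afterwards no letter is inserted below it.\<close>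

definition greedy_invariant :: "nat \<Rightarrow> nat list \<Rightarrow> bool" where
  "greedy_invariant m w \<longleftrightarrow> distinct w \<and> (\<forall>x\<in>set w. 1 \<le> x) \<and> m \<le> length w \<and>
    greedy_walk m (patterns (Suc m) w) (red (window m w)) \<and>
    (set (patterns (Suc m) w) \<subseteq> perms_before (Suc m) (Suc m) 1 \<and> 1 \<in> set (window m w) \<or>
     perms_before (Suc m) (Suc m) 1 \<subseteq> set (patterns (Suc m) w) \<and> w ! (fact (Suc m) div 2) = 1)"

lemma greedy_invariant_start:
  assumes "1 \<le> m"
  shows "greedy_invariant m [1..<Suc m]"
proof -
  have "patterns (Suc m) [1..<Suc m] = []" "window m [1..<Suc m] = [1..<Suc m]"
    by (simp_all add: patterns_def window_def)
  then show ?thesis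
    using assms greedy_walk.start red_permutation[OF upt_in_permutations, of m]
    by (auto simp: greedy_invariant_def)
qed

lemma greedy_invariant_step:
  assumes m: "2 \<le> m" and inv: "greedy_invariant m w" and ex: "\<exists>i. admissible (Suc m) w i"
  shows "greedy_invariant m (greedy_step (Suc m) w)"
    and "length (greedy_step (Suc m) w) = Suc (length w)"
proof -
  let ?F = "perms_before (Suc m) (Suc m) 1"
  let ?d = "\<lambda>v. if occurs_before v m 1 then m else 1"
  let ?N = "fact (Suc m) div 2 :: nat"
  interpret F: preferred_edges m ?F ?d by (rule preferred_edges_max_before_min[OF m])
  define v where "v = window m w"
  define p where "p = red v"
  define es where "es = patterns (Suc m) w"
  have w: "distinct w" "\<forall>x\<in>set w. 1 \<le> x" "m \<le> length w"
    and walk: "greedy_walk m es p"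
    and cases: "set es \<subseteq> ?F \<and> 1 \<in> set v \<or> ?F \<subseteq> set es \<and> w ! ?N = 1"
    using inv by (auto simp: greedy_invariant_def v_def p_def es_def)
  have v: "distinct v" "v \<noteq> []" "length v = m" "\<forall>x\<in>set v. 1 \<le> x"
    using w m by (auto simp: v_def window_def dest: in_set_dropD)
  have pV: "p \<in> permutations_of_set {1..m}" using greedy_walk_wf(1)[OF walk] .
  have adm: "admissible (Suc m) w i \<longleftrightarrow> i \<in> {1..Suc m} \<and> snoc_rank i p \<notin> set es" for i
    using admissible_iff[OF w(1,2) _ w(3)] m by (simp add: v_def p_def es_def)
  define i where "i = (LEAST i. admissible (Suc m) w i)"
  have "admissible (Suc m) w i" unfolding i_def using ex by (rule LeastI_ex)
  then have i: "i \<in> {1..Suc m}" "snoc_rank i p \<notin> set es" using adm by auto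
  have least: "\<forall>j\<in>{1..<i}. snoc_rank j p \<in> set es"
  proof
    fix j assume j: "j \<in> {1..<i}"
    then have "\<not> admissible (Suc m) w j" unfolding i_def by (auto dest: not_less_Least)
    then show "snoc_rank j p \<in> set es" using adm j i(1) by auto
  qed
  obtain b where b: "extension i v = map (shift b) v @ [b]" "1 \<le> b"
    "i = Suc (card {x \<in> set v. x < b})"
    using extension_eq_shift[OF v(1,2) _ v(4)] i(1) v(3) by metis
  define w' where "w' = map (shift b) w @ [b]"
  have step: "greedy_step (Suc m) w = w'"
    using b(1) by (simp add: greedy_step_def Let_def i_def[symmetric] v_def window_def w'_def)
  show "length (greedy_step (Suc m) w) = Suc (length w)" by (simp add: step w'_def)
  have es': "patterns (Suc m) w' = es @ [snoc_rank i p]"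
    using patterns_snoc[OF w(3)] red_map_shift_snoc[OF b(3)]
    by (simp add: w'_def es_def v_def p_def)
  have v': "window m w' = tl (map (shift b) v @ [b])"
    using window_snoc[OF _ w(3)] m by (simp add: w'_def v_def)
  have "red (window m w') = red (tl (snoc_rank i p))"
    using red_tl_red[of "map (shift b) v @ [b]"] red_map_shift_snoc[OF b(3)]
    by (simp add: v' p_def)
  then have walk': "greedy_walk m (patterns (Suc m) w') (red (window m w'))"
    using greedy_walk.step[OF walk i least] by (simp add: es')
  have "b \<notin> shift b ` set w" by (metis imageE shift_neq)
  then have "distinct w'"
    using w(1) inj_on_subset[OF inj_shift] by (auto simp: w'_def distinct_map)
  moreover have "\<forall>x\<in>set w'. 1 \<le> x" using w(2) b(2) by (auto simp: w'_def shift_def)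
  moreover have "m \<le> length w'" using w(3) by (simp add: w'_def)
  moreover have b_gt: "1 < b" if "i \<noteq> 1"
  proof -
    have "card {x \<in> set v. x < b} \<noteq> 0" using b(3) that by simp
    then have "{x \<in> set v. x < b} \<noteq> {}" by (metis card.empty)
    then obtain x where "x \<in> set v" "x < b" by blast
    then show ?thesis using v(4) by force
  qed
  have lenes: "length es = length w - m" by (simp add: es_def patterns_def)
  have "?N = card ?F" using card_perms_before[of "Suc m"] m by simp
  \<comment> \<open>Once \<open>?F\<close> is used up, position \<open>?N\<close> lies inside the
    old word, and its letter 1 is below \<open>b\<close> and so is not shifted.\<close>
  have keep: "w' ! ?N = 1" if "w ! ?N = 1" "?F \<subseteq> set es" "i \<noteq> 1"
  proof -
    have "card ?F \<le> length es"
      using card_mono[OF _ that(2)] card_length[of es] by simp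
    then have "?N < length w" using \<open>?N = card ?F\<close> lenes w(3) m by simp
    then show ?thesis using that b_gt by (simp add: w'_def nth_append shift_def)
  qed
  have "set (patterns (Suc m) w') \<subseteq> ?F \<and> 1 \<in> set (window m w') \<or>
      ?F \<subseteq> set (patterns (Suc m) w') \<and> w' ! ?N = 1"
    using cases
  proof (elim disjE conjE)
    assume FS: "?F \<subseteq> set es" and "w ! ?N = 1"
    \<comment> \<open>The edge with last entry 1 is preferred at every vertex, hence used already,
      so no new letter 1 appears.\<close>
    have "snoc_rank 1 p \<in> ?F" using F.out_edges[OF pV, of 1] m by simp
    then have "i \<noteq> 1" using FS i(2) by blast
    then show ?thesis using keep FS \<open>w ! ?N = 1\<close> by (auto simp: es')
  next
    assume sub: "set es \<subseteq> ?F" and one: "1 \<in> set v"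
    show ?thesis
    proof (cases "snoc_rank i p \<in> ?F")
      case True
      have "1 \<in> set (window m w')"
      proof (cases "i = 1")
        case True
        then have "{x \<in> set v. x < b} = {}" using b(3) by simp
        \<comment> \<open>The window contains 1 and no letter below \<open>b\<close>, so the new
          letter is itself the 1 of the next window.\<close>
        then have "b = 1" using one b(2) by force
        then show ?thesis using v(2) by (cases v) (auto simp: v')
      next
        case False
        obtain a t where at: "v = a # t" using v(2) by (cases v) auto
        have ob: "occurs_before p m 1"
          using True False F.out_edges[OF pV i(1)] i(1) by (auto split: if_splits)
        \<comment> \<open>A preferred choice other than 1 requires the maximum of \<open>p\<close>
          to precede its minimum, so the letter 1 is not the one that leaves the window.\<close>
        have "a \<noteq> 1"
        proof
          assume "a = 1"
          then have "{y \<in> set v. y \<le> a} = {1}" using v(4) one by force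
          then have "hd p = 1" unfolding p_def at red_def by (simp add: at)
          moreover have "p \<noteq> []" using v(2) by (simp add: p_def red_def)
          ultimately obtain p' where p': "p = 1 # p'" by (metis list.collapse)
          then have "1 \<in> set p'" using ob m by (auto dest: occurs_before_in_set)
          then show False using permutations_of_setD(2)[OF pV] p' by simp
        qed
        then have "1 \<in> set t" using one at by auto
        moreover have "shift b 1 = 1" using b_gt[OF False] by (simp add: shift_def)
        ultimately show ?thesis by (force simp: v' at)
      qed
      then show ?thesis using True sub by (simp add: es')
    next
      case False
      then have "?d p < i" using F.out_edges[OF pV i(1)] by (metis not_le)
      then have stuck: "\<forall>j\<in>{1..?d p}. snoc_rank j p \<in> set es" using least by auto
      have p_eq: "p = [1..<Suc m]" and es_eq: "set es = ?F"
        using F.stuck_walk[OF walk sub stuck] by blast+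
      have "length es = ?N"
        using distinct_card[OF greedy_walk_wf(3)[OF walk]] es_eq \<open>?N = card ?F\<close> by simp
      \<comment> \<open>When the walk leaves \<open>?F\<close> it has used \<open>?N\<close> edges,
        so the window begins at position \<open>?N\<close>. Its pattern is increasing, so its first
        letter is its smallest, namely 1.\<close>
      then have "w ! ?N = v ! 0" using lenes w(3) by (simp add: v_def window_def)
      moreover have "v ! 0 = 1"
      proof -
        have "p ! 0 = 1" using p_eq m by simp
        then have "card {y \<in> set v. y \<le> v ! 0} = 1" using v(2) by (simp add: p_def red_def)
        then obtain z where z: "{y \<in> set v. y \<le> v ! 0} = {z}" by (metis card_1_singletonE)
        have "v ! 0 \<in> {y \<in> set v. y \<le> v ! 0}" "1 \<in> {y \<in> set v. y \<le> v ! 0}"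
          using v(2,4) one by simp_all
        then show ?thesis unfolding z by simp
      qed
      moreover have "i \<noteq> 1" using \<open>?d p < i\<close> m by (auto split: if_splits)
      ultimately have "w' ! ?N = 1" using keep es_eq by simp
      then show ?thesis using es_eq unfolding es' set_append by blast
    qed
  qed
  ultimately show "greedy_invariant m (greedy_step (Suc m) w)"
    using walk' unfolding step greedy_invariant_def by blast
qed

section \<open>Termination and the final word\<close>

text \<open>The walk never repeats a pattern, which bounds the number of steps and yields
  termination.\<close>

lemma length_patterns_le:
  assumes "greedy_invariant m w"
  shows "length w - m \<le> fact (Suc m)"
proof -
  let ?es = "patterns (Suc m) w"
  have walk: "greedy_walk m ?es (red (window m w))"
    using assms by (simp add: greedy_invariant_def)
  have "card (set ?es) \<le> card (permutations_of_set {1..Suc m})"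
    using greedy_walk_wf(2)[OF walk] by (intro card_mono) auto
  then show ?thesis
    using distinct_card[OF greedy_walk_wf(3)[OF walk]]
    by (simp add: patterns_def del: fact_Suc)
qed

lemma greedy_output_properties:
  assumes m: "2 \<le> m"
  defines "w \<equiv> greedy_output (Suc m)"
  shows "greedy_walk m (patterns (Suc m) w) (red (window m w))"
    and "set (patterns (Suc m) w) = permutations_of_set {1..Suc m}"
    and "w ! (fact (Suc m) div 2) = 1"
proof -
  let ?n = "Suc m"
  have inv: "greedy_invariant m w \<and> (\<nexists>i. admissible ?n w i)"
    unfolding w_def greedy_output_def
  proof (rule while_rule[where P = "greedy_invariant m"
        and r = "measure (\<lambda>w. fact ?n + m + 1 - length w)"])
    show "greedy_invariant m [1..<?n]" using m by (intro greedy_invariant_start) simp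
  next
    fix w assume w: "greedy_invariant m w" "\<exists>i. admissible ?n w i"
    show "greedy_invariant m (greedy_step ?n w)" using greedy_invariant_step(1)[OF m w] .
    \<comment> \<open>By this bound the measure is positive before each step, so it strictly
      decreases despite truncated subtraction.\<close>
    have "length w \<le> fact ?n + m" using length_patterns_le[OF w(1)] by linarith
    then show "(greedy_step ?n w, w) \<in> measure (\<lambda>w. fact ?n + m + 1 - length w)"
      using greedy_invariant_step(2)[OF m w] by (simp del: fact_Suc)
  qed auto
  show walk: "greedy_walk m (patterns ?n w) (red (window m w))"
    using inv by (simp add: greedy_invariant_def)
  have w: "distinct w" "\<forall>x\<in>set w. 1 \<le> x" "m \<le> length w"
    using inv by (auto simp: greedy_invariant_def)
  have "\<forall>i\<in>{1..?n}. snoc_rank i (red (window m w)) \<in> set (patterns ?n w)"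
    using inv admissible_iff[OF w(1,2) _ w(3)] m by auto
  then show all: "set (patterns ?n w) = permutations_of_set {1..?n}"
    using preferred_edges.stuck_walk(2)[OF preferred_edges_all walk greedy_walk_wf(2)[OF walk]]
    by blast
  \<comment> \<open>The identity occurs as a pattern but has 1 before the maximum, which excludes
    the first alternative of the invariant.\<close>
  have "[1..<Suc ?n] \<in> permutations_of_set {1..?n}" by (rule upt_in_permutations)
  moreover have "[1..<Suc ?n] \<notin> perms_before ?n ?n 1"
    using not_occurs_before_red_snoc[of "[1..<?n]" ?n] red_permutation[OF upt_in_permutations, of ?n] m
    by (simp add: perms_before_eq upt_Suc)
  ultimately show "w ! (fact ?n div 2) = 1"
    using inv all by (auto simp: greedy_invariant_def)
qed

theorem theorem3p1:
  fixes n :: nat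
  assumes "n \<ge> 3"
  shows "greedy_output n ! (fact n div 2) = 1
    \<and> sigma n (fact n div 2) = n # [1..<n]
    \<and> sigma n (fact n div 2 + 1) = 1 # [3..<n + 1] @ [2]
    \<and> sigma n (fact n div 2 + 2) = [2..<n] @ [1, n]
    \<and> {sigma n k | k. 1 \<le> k \<and> k \<le> fact n div 2} = perms_before n n 1
    \<and> {sigma n k | k. fact n div 2 < k \<and> k \<le> fact n} = perms_before n 1 n"
proof -
  obtain m where n: "n = Suc m" and m: "2 \<le> m" using assms by (cases n) auto
  let ?N = "fact n div 2 :: nat"
  define es where "es = patterns n (greedy_output n)"
  note out = greedy_output_properties[OF m, folded n, folded es_def]
  note halves = greedy_walk_halves[OF m out(1), folded n, OF out(2)]
  have dist: "distinct es" using greedy_walk_wf(3)[OF out(1)] .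
  \<comment> \<open>The bound on \<open>k\<close> keeps the position inside \<open>es\<close>, whose
    length is \<open>fact n\<close>.\<close>
  have sigma: "sigma n k = es ! (k - 1)" if "1 \<le> k" "k \<le> fact n" for k
  proof -
    have "k - 1 < fact n" using that by simp
    then show ?thesis using halves(1) by (simp add: sigma_def es_def patterns_def)
  qed
  have "(6::nat) = fact 3" by (simp add: numeral_3_eq_3)
  also have "\<dots> \<le> fact n" using assms by (intro fact_mono_nat)
  finally have N: "1 \<le> ?N" "?N + 2 \<le> fact n" by linarith+
  have first: "{sigma n k | k. 1 \<le> k \<and> k \<le> ?N} = set (take ?N es)"
  proof (intro set_eqI iffI)
    fix e assume "e \<in> {sigma n k | k. 1 \<le> k \<and> k \<le> ?N}"
    then obtain k where k: "1 \<le> k" "k \<le> ?N" "e = sigma n k" by blast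
    then have "e = es ! (k - 1)" "k - 1 < ?N" "k - 1 < length es"
      using sigma N halves(1) by auto
    then show "e \<in> set (take ?N es)" by (auto simp: in_set_conv_nth)
  next
    fix e assume "e \<in> set (take ?N es)"
    then obtain j where "j < ?N" "e = es ! j" by (auto simp: in_set_conv_nth)
    then show "e \<in> {sigma n k | k. 1 \<le> k \<and> k \<le> ?N}"
      using sigma[of "Suc j"] N by (intro CollectI exI[of _ "Suc j"]) simp
  qed
  have "{sigma n k | k. ?N < k \<and> k \<le> fact n} = set (drop ?N es)"
  proof (intro set_eqI iffI)
    fix e assume "e \<in> {sigma n k | k. ?N < k \<and> k \<le> fact n}"
    then obtain k where k: "?N < k" "k \<le> fact n" "e = sigma n k" by blast
    then have "e = drop ?N es ! (k - 1 - ?N)" "k - 1 - ?N < length (drop ?N es)"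
      using sigma[of k] halves(1) by auto
    then show "e \<in> set (drop ?N es)" by (metis nth_mem)
  next
    fix e assume "e \<in> set (drop ?N es)"
    then obtain j where "j < length es - ?N" "e = es ! (?N + j)" by (auto simp: in_set_conv_nth)
    then show "e \<in> {sigma n k | k. ?N < k \<and> k \<le> fact n}"
      using sigma[of "Suc (?N + j)"] halves(1) by (intro CollectI exI[of _ "Suc (?N + j)"]) simp
  qed
  \<comment> \<open>No pattern is repeated, so the second half is the complement of the
    first.\<close>
  also have "\<dots> = set es - set (take ?N es)"
    using dist set_take_disj_set_drop_if_distinct[OF dist, of ?N ?N]
    by (metis Diff_cancel Diff_triv Un_Diff append_take_drop_id inf_commute le_refl set_append sup_bot_left)
  also have "\<dots> = perms_before n 1 n"
    using perms_before_complement[of n] out(2) halves(2) assms by simp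
  finally have second: "{sigma n k | k. ?N < k \<and> k \<le> fact n} = perms_before n 1 n" .
  show ?thesis
    using out(3) first second halves(2-5) sigma[of ?N] sigma[of "?N + 1"] sigma[of "?N + 2"] N n
    by simp
qed

end
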